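(* There do not exist real constants $c>0$ and $\beta$ such that $$\exp\big(\mathbb{P}_{n}^{T}(x)\big)\sim cx(\log x)^{\beta}\qquad\text{as } x\to\infty$$ for some positive integer $n$, or $$\exp\big(\mathrm{Diag}\mathbb{P}(x)\big)\sim cx(\log x)^{\beta}\qquad\text{as } x\to\infty.$$ That is, neither asymptotic relation holds for any real $c>0$, any real $\beta$ and (in the first case) any positive integer $n$.
   Context: $p_n$ denotes the $n$th prime number ($p_1=2$, $p_2=3$, ...). For positive integers $n,k$, define $p_n^{(k)}$ recursively by $p_n^{(1)}:=p_n$ and $p_n^{(k)}:=p_{p_n^{(k-1)}}$ for $k\ge 2$. Let $\mathbb{N}$ be the set of positive integers, and define the sets $\mathrm{Diag}\mathbb{P}:=\{p_k^{(k)} : k\in\mathbb{N}\}$ and $\mathbb{P}_n^T:=\{p_n^{(k)} : k\in\mathbb{N}\}$ for each $n\in\mathbb{N}$. For a set $A\subseteq\mathbb{N}$, its counting function is $A(x):=\#(A\cap[1,x])$; thus $\mathrm{Diag}\mathbb{P}(x)$ and $\mathbb{P}_n^T(x)$ are the counting functions of the sets above. $\log$ is the natural logarithm, and $f\sim g$ means $\lim_{x\to\infty} f(x)/g(x)=1$. *)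

theory Defs
  imports
    Complex_Main
    "HOL-Library.Landau_Symbols"
    "HOL-Library.Infinite_Set"
    "HOL-Computational_Algebra.Primes"
begin

text \<open>
  \<open>enumerate\<close> counts from 0, whereas the primes are indexed from 1
  (so that \<open>nth_prime 1 = 2\<close>); the value at index 0 is irrelevant.
\<close>
definition nth_prime :: "nat \<Rightarrow> nat" where
  "nth_prime n = enumerate {p. prime p} (n - 1)"

text \<open>
  \<open>iter_prime n k\<close> is $p_n^{(k)}$. The recursion is started at $p_n^{(0)} = n$, so that
  $p_n^{(1)} = p_n$ and $p_n^{(k)} = p_{p_n^{(k-1)}}$ for $k \geq 2$.
\<close>
primrec iter_prime :: "nat \<Rightarrow> nat \<Rightarrow> nat" where
  "iter_prime n 0 = n"
| "iter_prime n (Suc k) = nth_prime (iter_prime n k)"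

lemma iter_prime_1: "iter_prime n 1 = nth_prime n"
  by simp

lemma iter_prime_rec: "k \<ge> 2 \<Longrightarrow> iter_prime n k = nth_prime (iter_prime n (k - 1))"
  by (cases k) auto

definition diag_primes :: "nat set" where
  "diag_primes = {iter_prime k k | k. k \<ge> 1}"

definition iter_primes :: "nat \<Rightarrow> nat set" where
  "iter_primes n = {iter_prime n k | k. k \<ge> 1}"

definition counting_fun :: "nat set \<Rightarrow> real \<Rightarrow> nat" where
  "counting_fun A x = card {a \<in> A. 1 \<le> a \<and> real a \<le> x}"

end

theory Submission
  imports Defs "HOL-Real_Asymp.Real_Asymp"
begin

text \<open>
  The set in question is infinite, and each time \<open>x\<close> reaches one of its elements the
  counting function jumps by 1, so its exponential is multiplied by \<open>e\<close>. A function \<open>g\<close> with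
  \<open>g (x - 1/2) \<sim> g x\<close>, such as $cx(\log x)^\beta$, cannot follow these jumps.
\<close>

text \<open>The only natural number in the half-open interval from a - 1/2 (excluded) to a
  (included) is a itself.\<close>

lemma counting_fun_jump:
  assumes "a \<in> A" "a \<ge> 1"
  shows "counting_fun A (real a) = Suc (counting_fun A (real a - 1/2))"
proof -
  let ?B = "{b \<in> A. 1 \<le> b \<and> real b \<le> real a - 1/2}"
  have "{b \<in> A. 1 \<le> b \<and> real b \<le> real a} = insert a ?B"
    using assms by auto
  moreover have "?B \<subseteq> {..a}"
    by auto
  then have "finite ?B"
    by (rule finite_subset) simp
  moreover have "a \<notin> ?B"
    by simp
  ultimately show ?thesis
    unfolding counting_fun_def by (simp del: mem_Collect_eq)
qed

lemma exp_counting_fun_not_asymp_equiv: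
  fixes g :: "real \<Rightarrow> real"
  assumes "infinite A" and shift: "(\<lambda>x. g (x - 1/2)) \<sim>[at_top] g"
  shows "\<not> (\<lambda>x. exp (real (counting_fun A x))) \<sim>[at_top] g"
proof
  define F where "F = (\<lambda>x. exp (real (counting_fun A x)))"
  assume "(\<lambda>x. exp (real (counting_fun A x))) \<sim>[at_top] g"
  then have Fg: "F \<sim>[at_top] g"
    by (simp add: F_def)
  have "filterlim (\<lambda>x::real. x - 1/2) at_top at_top"
    by real_asymp
  with Fg have "(\<lambda>x. F (x - 1/2)) \<sim>[at_top] (\<lambda>x. g (x - 1/2))"
    by (rule asymp_equiv_compose')
  also note shift
  also have "g \<sim>[at_top] F"
    using Fg by (rule asymp_equiv_symI)
  finally have "(\<lambda>x. F (x - 1/2)) \<sim>[at_top] F" .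
  \<comment> \<open>\<open>asymp_equiv\<close> allows for common zeros of both sides; as
    \<open>F\<close> is positive, the plain quotient converges.\<close>
  then have "((\<lambda>x. F (x - 1/2) / F x) \<longlongrightarrow> 1) at_top"
    by (rule asymp_equivD_strong) (intro always_eventually, simp add: F_def)
  \<comment> \<open>The bound \<open>exp (-1)\<close>, below the limit 1, is exactly the value of
    the quotient at every positive element of \<open>A\<close>.\<close>
  then have "\<forall>\<^sub>F x in at_top. exp (-1) < F (x - 1/2) / F x"
    by (rule order_tendstoD) simp
  then obtain X where X: "\<And>x. x \<ge> X \<Longrightarrow> exp (-1) < F (x - 1/2) / F x"
    by (auto simp: eventually_at_top_linorder)
  \<comment> \<open>Exceeding a natural number also forces a \<ge> 1, which the jump lemma
    requires.\<close>
  obtain a where a: "a \<in> A" "a > nat \<lceil>X\<rceil>"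
    using \<open>infinite A\<close> by (auto simp: infinite_nat_iff_unbounded)
  then have "real a \<ge> X"
    by linarith
  moreover have "F (real a - 1/2) / F (real a) = exp (-1)"
    using a by (simp add: F_def counting_fun_jump flip: exp_diff)
  ultimately show False
    using X by force
qed

text \<open>The enumeration starts at index 0 with a prime, hence at 2 or more, and is strictly
  increasing. The offset 2 outweighs the index shift in \<open>nth_prime\<close>.\<close>

lemma enumerate_primes_ge: "k + 2 \<le> enumerate {p::nat. prime p} k"
proof (induction k)
  case 0
  have "prime (enumerate {p::nat. prime p} 0)"
    using enumerate_in_set[OF primes_infinite, of 0] by blast
  then show ?case
    using prime_ge_2_nat by (metis add_0)
next
  case (Suc k)
  then show ?case
    using enumerate_step[OF primes_infinite, of k] by linarith
qed

lemma less_nth_prime: "n < nth_prime n"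
  using enumerate_primes_ge[of "n - 1"] by (simp add: nth_prime_def)

lemma iter_prime_ge: "n + k \<le> iter_prime n k"
proof (induction k)
  case (Suc k)
  then show ?case
    using less_nth_prime[of "iter_prime n k"] by simp
qed simp

lemma infinite_iter_primes: "infinite (iter_primes n)"
  unfolding infinite_nat_iff_unbounded iter_primes_def
proof
  fix m
  \<comment> \<open>The index \<open>Suc m\<close> makes the lower bound n + m + 1 exceed m and is
    itself at least 1.\<close>
  have "m < iter_prime n (Suc m)"
    using iter_prime_ge[of n "Suc m"] by linarith
  then show "\<exists>a>m. a \<in> {iter_prime n k |k. k \<ge> 1}"
    by (metis (mono_tags, lifting) mem_Collect_eq le_add1 plus_1_eq_Suc)
qed

lemma infinite_diag_primes: "infinite diag_primes"
  unfolding infinite_nat_iff_unbounded diag_primes_def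
proof
  fix m
  have "m < iter_prime (Suc m) (Suc m)"
    using iter_prime_ge[of "Suc m" "Suc m"] by linarith
  then show "\<exists>a>m. a \<in> {iter_prime k k |k. k \<ge> 1}"
    by (metis (mono_tags, lifting) mem_Collect_eq le_add1 plus_1_eq_Suc)
qed

text \<open>This supplies the shift hypothesis for the candidate function. Asymptotic equivalence
  respects products, so each factor is compared separately.\<close>

lemma x_ln_powr_shift:
  fixes c \<beta> :: real
  shows "(\<lambda>x. c * (x - 1/2) * ln (x - 1/2) powr \<beta>) \<sim>[at_top] (\<lambda>x. c * x * ln x powr \<beta>)"
proof -
  have "(\<lambda>x::real. x - 1/2) \<sim>[at_top] (\<lambda>x. x)"
    by real_asymp
  moreover have "(\<lambda>x::real. ln (x - 1/2) powr \<beta>) \<sim>[at_top] (\<lambda>x. ln x powr \<beta>)"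
    by real_asymp
  ultimately show ?thesis
    by (intro asymp_equiv_mult asymp_equiv_refl)
qed

theorem corollary3p4:
  shows "\<not> (\<exists>(c::real) (\<beta>::real). c > 0 \<and>
    ((\<exists>n::nat. n \<ge> 1 \<and>
        (\<lambda>x::real. exp (real (counting_fun (iter_primes n) x)))
          \<sim>[at_top] (\<lambda>x. c * x * ln x powr \<beta>)) \<or>
     (\<lambda>x::real. exp (real (counting_fun diag_primes x)))
       \<sim>[at_top] (\<lambda>x. c * x * ln x powr \<beta>)))"
  using exp_counting_fun_not_asymp_equiv[OF infinite_iter_primes x_ln_powr_shift]
    exp_counting_fun_not_asymp_equiv[OF infinite_diag_primes x_ln_powr_shift]
  by blast

end
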